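(* For $n\ge1$ and $0\le p\le n-1$ let $G_{n,p}$ be the number of configurations of size $n$ in which exactly $p$ other pairs contain the given pair, and let $\mathcal G_n(p)=G_{n,p}/(n\,(2n-1)!!)$. Define the asymptotic distribution $\mathcal G(x)=\lim_{n\to\infty}(n-1)\,\mathcal G_n\bigl((n-1)x\bigr)$ for $x=\lim_{n\to\infty}p/(n-1)\in[0,1]$. Then $$\mathcal G(x)=\begin{cases}2\tanh^{-1}\sqrt{1-2x}, & 0< x<1/2,\\ 0, & 1/2\le x\le 1.\end{cases}$$
   Context: Fix $n\ge1$. A configuration (of size $n$) is a perfect matching of the $2n$ points $1,2,\dots,2n$ (laid out on a line) into $n$ unordered pairs, together with one distinguished pair, called the given pair; the other $n-1$ pairs are treated as indistinguishable, so there are $n\,(2n-1)!!$ configurations. Let the given pair be $\{g<h\}$ and let $\{a<b\}$ be another pair. The pair $\{a,b\}$ contains the given pair if $a<g<h<b$. *)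

theory Defs
  imports Complex_Main "HOL-Library.Disjoint_Sets"
begin

definition perfect_matchings :: "nat \<Rightarrow> nat set set set" where
  "perfect_matchings n = {M. partition_on {1..2 * n} M \<and> (\<forall>e\<in>M. card e = 2)}"

text \<open>The second component of a configuration is the given pair. Since the first one is a
  set, the other pairs are indistinguishable.\<close>

definition configurations :: "nat \<Rightarrow> (nat set set \<times> nat set) set" where
  "configurations n = {(M, e). M \<in> perfect_matchings n \<and> e \<in> M}"

definition contains_pair :: "nat set \<Rightarrow> nat set \<Rightarrow> bool" where
  "contains_pair f e \<longleftrightarrow>
     (\<exists>a b g h. f = {a, b} \<and> e = {g, h} \<and> a < g \<and> g < h \<and> h < b)"

definition num_containing :: "nat set set \<times> nat set \<Rightarrow> nat" where
  "num_containing = (\<lambda>(M, e). card {f \<in> M - {e}. contains_pair f e})"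

definition G_count :: "nat \<Rightarrow> nat \<Rightarrow> nat" where
  "G_count n p = card {c \<in> configurations n. num_containing c = p}"

text \<open>The product is the double factorial of \<open>2 * n - 1\<close>.\<close>

definition G_dist :: "nat \<Rightarrow> nat \<Rightarrow> real" where
  "G_dist n p = real (G_count n p) / real (n * (\<Prod>k=1..n. 2 * k - 1))"

text \<open>The asymptotic distribution has value \<open>y\<close> at \<open>x\<close>: the rescaled probabilities tend
  to \<open>y\<close> along every sequence of counts \<open>p n\<close> in the range \<open>0..n - 1\<close> whose proportion
  \<open>p n / (n - 1)\<close> tends to \<open>x\<close>. Such sequences exist for every \<open>x\<close> in \<open>[0, 1]\<close>, for
  example \<open>\<lambda>n. nat \<lfloor>real (n - 1) * x\<rfloor>\<close>.\<close>

definition has_asymptotic_value :: "real \<Rightarrow> real \<Rightarrow> bool" where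
  "has_asymptotic_value x y \<longleftrightarrow>
     (\<forall>p :: nat \<Rightarrow> nat.
        (\<forall>n\<ge>1. p n \<le> n - 1) \<and> (\<lambda>n. real (p n) / real (n - 1)) \<longlonglongrightarrow> x
        \<longrightarrow> (\<lambda>n. real (n - 1) * G_dist n (p n)) \<longlonglongrightarrow> y)"

end

(* Let N = n - 1. Counting matchings together with k marked pairs around the given pair gives
   the binomial moments of the number X of pairs that contain the given pair,
   E (X choose k) = (N choose k) m(k) with m(k) = 2^(k+1) k!^2 / (2k+2)!, and m(k) is the k-th
   moment of the density f(t) = 2 artanh (sqrt (1 - 2t)) on (0, 1/2). So X is a mixture of
   binomial distributions: P(X = p) = (N choose p) * integral of t^p (1 - t)^(N - p) f(t). Since
   f is unbounded at 0, one factor t is moved to h(t) = t f(t), which is continuous on [0, 1].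
   What is left of the kernel is (up to the factor 1/p) the density of a beta distribution with
   mean tending to x and variance tending to 0, so the integral tends to h(x), and
   N P(X = p) ~ (N/p) h(x) tends to h(x) / x = f(x). *)

theory Submission imports Defs "HOL-Analysis.Analysis" begin

section \<open>Counting matchings\<close>

text \<open>Arbitrary ground sets replace \<open>{1..2 * n}\<close>, because deleting the points of
  a pair leaves a set that need not be an initial segment.\<close>

definition pairings :: "'a set \<Rightarrow> 'a set set set" where
  "pairings V = {M. partition_on V M \<and> (\<forall>e\<in>M. card e = 2)}"

text \<open>With \<open>L\<close> and \<open>R\<close> the points to the left and to the right of
  the given pair, these are the pairs that contain it. General \<open>L\<close> and \<open>R\<close>
  allow an induction that deletes one point from each.\<close>

definition cross :: "'a set \<Rightarrow> 'a set \<Rightarrow> 'a set set \<Rightarrow> 'a set set" where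
  "cross L R M = {f \<in> M. \<exists>a\<in>L. \<exists>b\<in>R. f = {a, b}}"

definition matching_count :: "nat \<Rightarrow> nat" where
  "matching_count n = (\<Prod>k=1..n. 2 * k - 1)"

lemma finite_pairings: "finite V \<Longrightarrow> finite (pairings V)"
  by (rule finite_subset[of _ "Pow (Pow V)"]) (auto simp: pairings_def partition_on_def)

lemma pairing_subset: "M \<in> pairings V \<Longrightarrow> e \<in> M \<Longrightarrow> e \<subseteq> V"
  by (auto simp: pairings_def partition_on_def)

lemma pairing_card: "M \<in> pairings V \<Longrightarrow> e \<in> M \<Longrightarrow> card e = 2"
  by (simp add: pairings_def)

lemma finite_pairing: "finite V \<Longrightarrow> M \<in> pairings V \<Longrightarrow> finite M"
  by (auto simp: pairings_def intro: finite_elements)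

lemma card_pairing:
  assumes "finite V" "M \<in> pairings V"
  shows "card V = 2 * card M"
proof -
  have "finite e" if "e \<in> M" for e
    using assms that by (intro card_ge_0_finite) (auto simp: pairings_def)
  then have "card V = (\<Sum>e\<in>M. card e)"
    using assms by (intro product_partition) (auto simp: pairings_def)
  then show ?thesis using assms by (simp add: pairings_def)
qed

lemma pairing_remove:
  assumes "M \<in> pairings V" "e \<in> M"
  shows "M - {e} \<in> pairings (V - e)"
  using assms by (fastforce simp: pairings_def partition_on_def disjoint_def)

lemma pairing_insert:
  assumes "M \<in> pairings (V - e)" "e \<subseteq> V" "card e = 2"
  shows "insert e M \<in> pairings V" and "e \<notin> M"
proof -
  have "e \<noteq> {}" using assms by auto
  then show "insert e M \<in> pairings V" and "e \<notin> M"
    using assms by (auto simp: pairings_def partition_on_def disjoint_def)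
qed

text \<open>Marking a pair of a matching amounts to choosing the pair first and then matching the
  remaining points; all counts below come from this double counting.\<close>

lemma sum_pairings_remove:
  fixes F :: "'a set \<Rightarrow> 'a set set \<Rightarrow> nat"
  assumes "finite V"
  shows "(\<Sum>M\<in>pairings V. \<Sum>e\<in>M. F e (M - {e})) =
         (\<Sum>e\<in>{e. e \<subseteq> V \<and> card e = 2}. \<Sum>M\<in>pairings (V - e). F e M)"
proof -
  have fin: "finite {e. e \<subseteq> V \<and> card e = 2}" using assms by simp
  have "(\<Sum>M\<in>pairings V. \<Sum>e\<in>M. F e (M - {e})) =
        (\<Sum>(M, e)\<in>Sigma (pairings V) (\<lambda>M. M). F e (M - {e}))"
    using assms finite_pairings finite_pairing by (subst sum.Sigma) auto
  also have "\<dots> = (\<Sum>(e, M)\<in>Sigma {e. e \<subseteq> V \<and> card e = 2} (\<lambda>e. pairings (V - e)). F e M)"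
    by (rule sum.reindex_bij_witness[where i = "\<lambda>(e, M). (insert e M, e)" and j = "\<lambda>(M, e). (e, M - {e})"])
      (auto simp: pairing_remove pairing_insert insert_absorb dest: pairing_subset pairing_card)
  also have "\<dots> = (\<Sum>e\<in>{e. e \<subseteq> V \<and> card e = 2}. \<Sum>M\<in>pairings (V - e). F e M)"
    using assms fin finite_pairings by (subst sum.Sigma) auto
  finally show ?thesis .
qed

text \<open>Matchings of \<open>2 * n + 2\<close> points with one marked pair are counted twice:
  through the \<open>n + 1\<close> pairs of each matching, and through the choice of the marked pair
  followed by a matching of the rest.\<close>

lemma card_pairings: "finite V \<Longrightarrow> card V = 2 * n \<Longrightarrow> card (pairings V) = matching_count n"
proof (induction n arbitrary: V)
  case 0
  then have "pairings V = {{}}" by (auto simp: pairings_def partition_on_def)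
  then show ?case by (simp add: matching_count_def)
next
  case (Suc n)
  have "card M = Suc n" if "M \<in> pairings V" for M
    using card_pairing[OF Suc.prems(1) that] Suc.prems(2) by simp
  then have "Suc n * card (pairings V) = (\<Sum>M\<in>pairings V. \<Sum>e\<in>M. 1)"
    by simp
  also have "\<dots> = (\<Sum>e\<in>{e. e \<subseteq> V \<and> card e = 2}. \<Sum>M\<in>pairings (V - e). 1)"
    by (rule sum_pairings_remove[OF Suc.prems(1)])
  also have "\<dots> = (\<Sum>e\<in>{e. e \<subseteq> V \<and> card e = 2}. matching_count n)"
  proof (rule sum.cong, goal_cases)
    case (2 e)
    then have "card (V - e) = 2 * n"
      using Suc.prems card_Diff_subset[of e V] by (auto dest: finite_subset)
    then show ?case using Suc by simp
  qed simp
  also have "\<dots> = (2 * Suc n choose 2) * matching_count n"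
    using Suc.prems by (simp add: n_subsets)
  also have "2 * Suc n choose 2 = Suc n * (2 * n + 1)"
    by (simp add: choose_two)
  finally have "Suc n * card (pairings V) = Suc n * ((2 * n + 1) * matching_count n)"
    by (simp only: mult.assoc)
  then have "card (pairings V) = (2 * n + 1) * matching_count n"
    by (simp only: mult_cancel1) simp
  then show ?case by (simp add: matching_count_def)
qed

text \<open>Both sides count matchings with \<open>k\<close> marked pairs between \<open>L\<close>
  and \<open>R\<close>: choose \<open>k\<close> endpoints on each side, join them in
  \<open>fact k\<close> ways, match the other \<open>2 * (n - k)\<close> points. The induction
  singles out one marked pair.\<close>

lemma sum_cross_choose:
  assumes "finite V" "card V = 2 * n" "L \<subseteq> V" "R \<subseteq> V" "L \<inter> R = {}" "k \<le> n"
  shows "(\<Sum>M\<in>pairings V. card (cross L R M) choose k) =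
         (card L choose k) * (card R choose k) * fact k * matching_count (n - k)"
  using assms
proof (induction k arbitrary: V L R n)
  case 0
  then show ?case by (simp add: card_pairings)
next
  case (Suc k)
  let ?P = "{e. e \<subseteq> V \<and> card e = 2}"
  let ?C = "\<lambda>e. \<exists>a\<in>L. \<exists>b\<in>R. e = {a, b}"
  let ?l = "card L" and ?r = "card R"
  obtain m where m: "n = Suc m" using Suc.prems by (cases n) auto
  have finLR: "finite L" "finite R" using Suc.prems by (auto dest: finite_subset)
  \<comment> \<open>Absorption, \<open>Suc k * (c choose Suc k) = c * (c - 1 choose k)\<close>: one
    of the \<open>Suc k\<close> marked pairs is distinguished.\<close>
  have crossF: "Suc k * (card (cross L R M) choose Suc k) =
     (\<Sum>e\<in>M. if ?C e then card (cross L R (M - {e})) choose k else 0)" if "M \<in> pairings V" for M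
  proof -
    have fM: "finite M" using that Suc.prems finite_pairing by blast
    have "(\<Sum>e\<in>M. if ?C e then card (cross L R (M - {e})) choose k else 0) =
          (\<Sum>e\<in>cross L R M. card (cross L R (M - {e})) choose k)"
      unfolding cross_def[of L R M] using fM by (simp add: sum.inter_filter)
    also have "\<dots> = (\<Sum>e\<in>cross L R M. (card (cross L R M) - 1) choose k)"
    proof (rule sum.cong, goal_cases)
      case (2 e)
      have "cross L R (M - {e}) = cross L R M - {e}" by (auto simp: cross_def)
      then show ?case using 2 fM by simp
    qed simp
    also have "\<dots> = card (cross L R M) * ((card (cross L R M) - 1) choose k)" by simp
    also have "\<dots> = Suc k * (card (cross L R M) choose Suc k)"
      by (cases "card (cross L R M)") (simp_all only: Suc_times_binomial diff_Suc_1 mult_0 binomial_0_Suc mult_0_right)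
    finally show ?thesis by simp
  qed
  have inner: "(\<Sum>M\<in>pairings (V - {a, b}). card (cross L R M) choose k) =
      (?l - 1 choose k) * (?r - 1 choose k) * fact k * matching_count (m - k)"
    if ab: "a \<in> L" "b \<in> R" for a b
  proof -
    have ne: "a \<noteq> b" using ab Suc.prems by auto
    have abV: "{a, b} \<subseteq> V" using ab Suc.prems by auto
    have "card (V - {a, b}) = card V - card {a, b}" using abV by (intro card_Diff_subset) auto
    then have c: "card (V - {a, b}) = 2 * m" using ne Suc.prems m by simp
    \<comment> \<open>No pair of \<open>M\<close> meets \<open>{a, b}\<close>. The induction
      hypothesis asks for sides inside the smaller ground set, so \<open>a\<close> and
      \<open>b\<close> are dropped from them.\<close>
    have "cross L R M = cross (L - {a}) (R - {b}) M" if "M \<in> pairings (V - {a, b})" for M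
    proof -
      have "f \<inter> {a, b} = {}" if "f \<in> M" for f
        using that \<open>M \<in> _\<close> by (auto simp: pairings_def partition_on_def)
      then show ?thesis unfolding cross_def by blast
    qed
    then have "(\<Sum>M\<in>pairings (V - {a, b}). card (cross L R M) choose k) =
       (\<Sum>M\<in>pairings (V - {a, b}). card (cross (L - {a}) (R - {b}) M) choose k)" by simp
    also have "\<dots> = (card (L - {a}) choose k) * (card (R - {b}) choose k) * fact k * matching_count (m - k)"
      by (rule Suc.IH) (use Suc.prems m c ab in auto)
    finally show ?thesis using ab finLR by simp
  qed
  have "Suc k * (\<Sum>M\<in>pairings V. card (cross L R M) choose Suc k) =
     (\<Sum>M\<in>pairings V. \<Sum>e\<in>M. if ?C e then card (cross L R (M - {e})) choose k else 0)"
    unfolding sum_distrib_left by (rule sum.cong[OF refl crossF])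
  also have "\<dots> = (\<Sum>e\<in>?P. \<Sum>M\<in>pairings (V - e). if ?C e then card (cross L R M) choose k else 0)"
    using sum_pairings_remove[OF Suc.prems(1), of "\<lambda>e M. if ?C e then card (cross L R M) choose k else 0"] .
  also have "\<dots> = (\<Sum>e\<in>{e \<in> ?P. ?C e}. \<Sum>M\<in>pairings (V - e). card (cross L R M) choose k)"
    using Suc.prems by (subst sum.inter_filter) (auto intro!: sum.cong)
  also have "{e \<in> ?P. ?C e} = (\<lambda>(a, b). {a, b}) ` (L \<times> R)" (is "_ = ?f ` _")
  proof -
    have "{a, b} \<in> ?P" if "a \<in> L" "b \<in> R" for a b
    proof -
      have "a \<noteq> b" using that Suc.prems by auto
      then show ?thesis using that Suc.prems by auto
    qed
    then show ?thesis by auto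
  qed
  also have "(\<Sum>e\<in>?f ` (L \<times> R). \<Sum>M\<in>pairings (V - e). card (cross L R M) choose k) =
     (\<Sum>(a, b)\<in>L \<times> R. \<Sum>M\<in>pairings (V - {a, b}). card (cross L R M) choose k)"
  proof (subst sum.reindex)
    show "inj_on ?f (L \<times> R)" using Suc.prems by (auto simp: inj_on_def doubleton_eq_iff)
  qed (simp add: case_prod_unfold)
  also have "\<dots> = (\<Sum>(a, b)\<in>L \<times> R. (?l - 1 choose k) * (?r - 1 choose k) * fact k * matching_count (m - k))"
    by (rule sum.cong) (auto simp: inner)
  also have "\<dots> = (?l * (?l - 1 choose k)) * (?r * (?r - 1 choose k)) * fact k * matching_count (m - k)"
    by (simp add: card_cartesian_product)
  \<comment> \<open>Absorption on both sides yields two factors \<open>Suc k\<close>: one cancels at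
    the end, the other turns \<open>fact k\<close> into \<open>fact (Suc k)\<close>.\<close>
  also have "?l * (?l - 1 choose k) = Suc k * (?l choose Suc k)"
    by (cases ?l) (simp_all only: Suc_times_binomial diff_Suc_1 mult_0 binomial_0_Suc mult_0_right)
  also have "?r * (?r - 1 choose k) = Suc k * (?r choose Suc k)"
    by (cases ?r) (simp_all only: Suc_times_binomial diff_Suc_1 mult_0 binomial_0_Suc mult_0_right)
  finally have "Suc k * (\<Sum>M\<in>pairings V. card (cross L R M) choose Suc k) =
     Suc k * ((?l choose Suc k) * (?r choose Suc k) * fact (Suc k) * matching_count (m - k))"
    by (simp only: fact_Suc of_nat_id mult_ac)
  then show ?case unfolding m by (simp only: mult_cancel1) simp
qed

section \<open>Summation over the positions of the given pair\<close>

text \<open>Classify the subsets of \<open>{0..m}\<close> with \<open>a + b + 1\<close> elements by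
  the element \<open>i\<close> that has \<open>a\<close> chosen elements below it and
  \<open>b\<close> above. The induction applies Pascal's rule to the second factor;
  \<open>b = 0\<close> is the hockey-stick identity.\<close>

lemma sum_choose_mult_choose:
  "(\<Sum>i\<le>m. (i choose a) * (m - i choose b)) = Suc m choose Suc (a + b)"
proof (induction m arbitrary: b)
  case 0
  then show ?case by (cases a; cases b) auto
next
  case (Suc m)
  show ?case
  proof (cases b)
    case 0
    then show ?thesis using sum_choose_upper[of a "Suc m"] by simp
  next
    case (Suc b')
    have "(\<Sum>i\<le>Suc m. (i choose a) * (Suc m - i choose b)) =
          (\<Sum>i\<le>m. (i choose a) * (m - i choose b')) + (\<Sum>i\<le>m. (i choose a) * (m - i choose b))"
      unfolding sum.distrib[symmetric]
      by (auto simp: Suc Suc_diff_le algebra_simps intro!: sum.cong)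
    then show ?thesis using Suc.IH Suc by simp
  qed
qed

lemma card_2_subsets_atLeastAtMost:
  fixes m :: nat
  shows "{e. e \<subseteq> {1..m} \<and> card e = 2} = (\<lambda>(h, g). {g, h}) ` Sigma {1..m} (\<lambda>h. {1..<h})"
proof (rule set_eqI, rule iffI)
  fix e assume "e \<in> {e. e \<subseteq> {1..m} \<and> card e = 2}"
  then obtain a b where e: "e = {a, b}" "a \<noteq> b" "e \<subseteq> {1..m}" by (auto simp: card_2_iff)
  show "e \<in> (\<lambda>(h, g). {g, h}) ` Sigma {1..m} (\<lambda>h. {1..<h})"
  proof (cases "a < b")
    case True
    then show ?thesis using e by (intro image_eqI[of _ _ "(b, a)"]) auto
  next
    case False
    then show ?thesis using e by (intro image_eqI[of _ _ "(a, b)"]) auto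
  qed
qed auto

text \<open>Among \<open>2 * k + 2\<close> chosen points let \<open>g < h\<close> be the two middle
  ones: \<open>k\<close> are chosen below \<open>g\<close>, \<open>k\<close> above \<open>h\<close>
  and none in between.\<close>

lemma sum_2_subsets_choose:
  "(\<Sum>h\<in>{1..m}. \<Sum>g\<in>{1..<h}. (g - 1 choose k) * (m - h choose k)) = m choose (2 * k + 2)"
proof (cases m)
  case (Suc m')
  have "(\<Sum>g\<in>{1..<h}. (g - 1 choose k) * (m - h choose k)) = (h - 1 choose Suc k) * (m - h choose k)"
    if "h \<in> {1..m}" for h
  proof -
    have "(\<Sum>g\<in>{1..<h}. g - 1 choose k) = (\<Sum>i<h - 1. i choose k)"
      by (rule sum.reindex_bij_witness[of _ Suc "\<lambda>g. g - 1"]) auto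
    also have "\<dots> = h - 1 choose Suc k"
      by (cases "h - 1") (simp_all add: lessThan_Suc_atMost sum_choose_upper)
    finally show ?thesis by (simp only: sum_distrib_right[symmetric])
  qed
  then have "(\<Sum>h\<in>{1..m}. \<Sum>g\<in>{1..<h}. (g - 1 choose k) * (m - h choose k)) =
    (\<Sum>h\<in>{1..m}. (h - 1 choose Suc k) * (m - h choose k))" by simp
  also have "\<dots> = (\<Sum>i\<le>m'. (i choose Suc k) * (m' - i choose k))"
    by (rule sum.reindex_bij_witness[of _ Suc "\<lambda>g. g - 1"]) (auto simp: Suc)
  also have "\<dots> = m choose (2 * k + 2)"
    by (simp add: sum_choose_mult_choose Suc mult_2)
  finally show ?thesis .
qed simp

lemma contains_pair_iff:
  assumes "g < h"
  shows "contains_pair f {g, h} \<longleftrightarrow> (\<exists>a b. f = {a, b} \<and> a < g \<and> h < b)"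
proof
  assume "contains_pair f {g, h}"
  then obtain a b g' h' where *: "f = {a, b}" "{g, h} = {g', h'}" "a < g'" "g' < h'" "h' < b"
    unfolding contains_pair_def by blast
  then have "g' = g" "h' = h" using assms by (metis doubleton_eq_iff order_less_asym)+
  then show "\<exists>a b. f = {a, b} \<and> a < g \<and> h < b" using * by blast
qed (use assms in \<open>unfold contains_pair_def, blast\<close>)

text \<open>This is the binomial moment before normalization. The given pair \<open>{g, h}\<close>
  is chosen first; the pairs that contain it then join \<open>{1..<g}\<close> to
  \<open>{h<..2 * n}\<close>, so \<open>sum_cross_choose\<close> applies, and
  \<open>sum_2_subsets_choose\<close> sums over \<open>g\<close> and \<open>h\<close>.\<close>

lemma sum_configurations_choose:
  assumes "k < n"
  shows "(\<Sum>c\<in>configurations n. num_containing c choose k) =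
         (2 * n choose (2 * k + 2)) * fact k * matching_count (n - 1 - k)"
proof -
  define V where "V = {1..2 * n}"
  have V: "finite V" "card V = 2 * n" by (auto simp: V_def)
  let ?P = "{e. e \<subseteq> V \<and> card e = 2}"
  let ?F = "\<lambda>e M. card {f \<in> M. contains_pair f e} choose k"
have "configurations n = Sigma (pairings V) (\<lambda>M. M)"
    by (auto simp: configurations_def perfect_matchings_def pairings_def V_def)
  then have "(\<Sum>c\<in>configurations n. num_containing c choose k) =
     (\<Sum>M\<in>pairings V. \<Sum>e\<in>M. ?F e (M - {e}))"
    using V finite_pairings finite_pairing
    by (subst sum.Sigma) (auto simp: num_containing_def case_prod_unfold)
  also have "\<dots> = (\<Sum>e\<in>?P. \<Sum>M\<in>pairings (V - e). ?F e M)"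
    by (rule sum_pairings_remove[OF V(1), of ?F])
  also have "?P = (\<lambda>(h, g). {g, h}) ` Sigma {1..2 * n} (\<lambda>h. {1..<h})" (is "_ = ?f ` ?S")
    unfolding V_def by (rule card_2_subsets_atLeastAtMost)
  also have "(\<Sum>e\<in>?f ` ?S. \<Sum>M\<in>pairings (V - e). ?F e M) =
     (\<Sum>(h, g)\<in>?S. \<Sum>M\<in>pairings (V - {g, h}). ?F {g, h} M)"
  proof (subst sum.reindex)
    show "inj_on ?f ?S" by (auto simp: inj_on_def doubleton_eq_iff)
  qed (simp add: case_prod_unfold)
  also have "\<dots> = (\<Sum>(h, g)\<in>?S. ((g - 1 choose k) * (2 * n - h choose k)) * (fact k * matching_count (n - 1 - k)))"
  proof (rule sum.cong, goal_cases)
    case (2 s)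
    then obtain g h where s: "s = (h, g)" "g < h" "1 \<le> g" "h \<le> 2 * n" by auto
    let ?L = "{1..<g}" and ?R = "{h<..2 * n}"
    have "card (V - {g, h}) = card V - card {g, h}" using s by (intro card_Diff_subset) (auto simp: V_def)
    then have c: "card (V - {g, h}) = 2 * (n - 1)" using s V by simp
    have "{f \<in> M. contains_pair f {g, h}} = cross ?L ?R M" if "M \<in> pairings (V - {g, h})" for M
    proof -
      have "f \<subseteq> {1..2 * n}" if "f \<in> M" for f
        using that \<open>M \<in> _\<close> by (auto simp: V_def pairings_def partition_on_def)
      then show ?thesis by (fastforce simp: cross_def contains_pair_iff[OF s(2)])
    qed
    then have "(\<Sum>M\<in>pairings (V - {g, h}). ?F {g, h} M) =
       (\<Sum>M\<in>pairings (V - {g, h}). card (cross ?L ?R M) choose k)" by simp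
    also have "\<dots> = (card ?L choose k) * (card ?R choose k) * fact k * matching_count (n - 1 - k)"
      by (rule sum_cross_choose) (use s c assms in \<open>auto simp: V_def\<close>)
    finally show ?case by (simp add: s)
  qed simp
  also have "\<dots> = (\<Sum>(h, g)\<in>?S. (g - 1 choose k) * (2 * n - h choose k)) * (fact k * matching_count (n - 1 - k))"
    by (simp add: sum_distrib_right case_prod_unfold)
  also have "(\<Sum>(h, g)\<in>?S. (g - 1 choose k) * (2 * n - h choose k)) = 2 * n choose (2 * k + 2)"
    by (subst sum_2_subsets_choose[symmetric], subst sum.Sigma) auto
  finally show ?thesis by simp
qed

section \<open>Binomial inversion\<close>

text \<open>This is the probability that all \<open>k\<close> other pairs of a configuration of size
  \<open>k + 1\<close> contain the given pair.\<close>

definition pair_moment :: "nat \<Rightarrow> real" where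
  "pair_moment k = 2 ^ Suc k * (fact k)\<^sup>2 / fact (2 * k + 2)"

lemma real_matching_count: "real (matching_count n) = fact (2 * n) / (2 ^ n * fact n)"
proof (induction n)
  case (Suc n)
  have "matching_count (Suc n) = (2 * n + 1) * matching_count n"
    by (simp add: matching_count_def)
  then have "real (matching_count (Suc n)) = (2 * real n + 1) * (fact (2 * n) / (2 ^ n * fact n))"
    using Suc by (simp add: field_simps)
  also have "\<dots> = fact (2 * Suc n) / (2 ^ Suc n * fact (Suc n))"
    by (simp add: divide_simps)
  finally show ?case .
qed (simp add: matching_count_def)

text \<open>The closed form of the double factorial puts all dependence on \<open>N\<close> into the
  number of configurations and into \<open>N choose k\<close>.\<close>

lemma matching_count_ratio:
  assumes "k \<le> N"
  shows "real ((2 * Suc N choose (2 * k + 2)) * fact k * matching_count (N - k)) =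
         real (Suc N * matching_count (Suc N)) * (real (N choose k) * pair_moment k)"
proof -
  obtain d where d: "N = k + d" using assms le_Suc_ex by blast
  have e: "2 * Suc N - (2 * k + 2) = 2 * d" using d by simp
  have "real (2 * Suc N choose (2 * k + 2)) = fact (2 * Suc N) / (fact (2 * k + 2) * fact (2 * d))"
    using assms by (subst binomial_fact) (simp_all only: e, simp)
  moreover have "real (N choose k) = fact N / (fact k * fact d)"
    by (subst binomial_fact) (use assms d in auto)
  moreover have "N - k = d" using d by simp
  moreover have "(2::real) ^ Suc N = 2 ^ Suc k * 2 ^ d" by (simp add: d power_add)
  moreover have "fact (Suc N) = real (Suc N) * fact N" by simp
  ultimately show ?thesis
    unfolding pair_moment_def of_nat_mult real_matching_count of_nat_fact
    by (simp del: fact_Suc power_Suc of_nat_Suc mult_Suc_right add: divide_simps power2_eq_square mult_ac)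
qed

lemma card_configurations_pos: "0 < Suc N * matching_count (Suc N)"
  by (auto simp: matching_count_def)

text \<open>Since \<open>(p + j choose p) * (c choose (p + j)) = (c choose p) * (c - p choose
  j)\<close>, the sum is \<open>c choose p\<close> times the expansion of
  \<open>(1 - 1) ^ (c - p)\<close>.\<close>

lemma alternating_binomial_indicator:
  assumes "c \<le> N" "p \<le> N"
  shows "(\<Sum>j\<le>N - p. (-1) ^ j * real (p + j choose p) * real (c choose (p + j))) = (if c = p then 1 else 0)"
proof (cases "p \<le> c")
  case True
  have "(\<Sum>j\<le>N - p. (-1) ^ j * real (p + j choose p) * real (c choose (p + j))) =
        (\<Sum>j\<le>N - p. real (c choose p) * ((-1) ^ j * real (c - p choose j)))"
  proof (rule sum.cong, goal_cases)
    case (2 j)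
    show ?case
    proof (cases "p + j \<le> c")
      case True
      then have "real (c choose (p + j)) * real (p + j choose p) = real (c choose p) * real (c - p choose j)"
        using choose_mult[of p "p + j" c] by (simp flip: of_nat_mult)
      then show ?thesis by (simp add: mult_ac)
    qed (auto simp: binomial_eq_0)
  qed simp
  also have "\<dots> = real (c choose p) * (\<Sum>j\<le>N - p. (-1) ^ j * real (c - p choose j))"
    by (simp add: sum_distrib_left)
  \<comment> \<open>The range shrinks because \<open>c \<le> N\<close> and the terms with
    \<open>j > c - p\<close> vanish.\<close>
  also have "(\<Sum>j\<le>N - p. (-1) ^ j * real (c - p choose j)) = (\<Sum>j\<le>c - p. (-1) ^ j * real (c - p choose j))"
    using assms by (intro sum.mono_neutral_right) auto
  also have "\<dots> = (if c = p then 1 else 0)"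
    using choose_alternating_sum[of "c - p", where 'a = real] True by (cases "c = p") auto
  finally show ?thesis by simp
qed (auto simp: binomial_eq_0)

text \<open>Applying \<open>alternating_binomial_indicator\<close> to each configuration and
  exchanging the sums expresses the distribution through the binomial moments.\<close>

lemma G_dist_alternating:
  assumes "p \<le> N"
  shows "G_dist (Suc N) p =
         real (N choose p) * (\<Sum>j\<le>N - p. (-1) ^ j * real (N - p choose j) * pair_moment (p + j))"
proof -
  let ?C = "configurations (Suc N)"
  define T where "T = real (Suc N * matching_count (Suc N))"
  have T: "T > 0" unfolding T_def using card_configurations_pos by (simp only: of_nat_0_less_iff)
  have "?C = Sigma (pairings {1..2 * Suc N}) (\<lambda>M. M)"
    by (auto simp: configurations_def perfect_matchings_def pairings_def)
  then have fin: "finite ?C"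
    by (auto intro!: finite_SigmaI finite_pairings intro: finite_pairing)
  have le: "num_containing c \<le> N" if "c \<in> ?C" for c
  proof -
    obtain M e where c: "c = (M, e)" "M \<in> pairings {1..2 * Suc N}" "e \<in> M"
      using \<open>c \<in> ?C\<close> by (auto simp: configurations_def perfect_matchings_def pairings_def)
    then have fM: "finite M" and "card M = Suc N"
      using finite_pairing[OF _ c(2)] card_pairing[OF _ c(2)] by auto
    then have "card (M - {e}) = N" using c by simp
    then show ?thesis using card_mono[of "M - {e}" "{f \<in> M - {e}. contains_pair f e}"] fM
      by (auto simp: num_containing_def c)
  qed
  have "real (G_count (Suc N) p) = (\<Sum>c\<in>?C. if num_containing c = p then 1 else 0)"
    unfolding G_count_def using fin by (simp add: sum.If_cases Int_def)
  also have "\<dots> = (\<Sum>c\<in>?C. \<Sum>j\<le>N - p. (-1) ^ j * real (p + j choose p) * real (num_containing c choose (p + j)))"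
    by (rule sum.cong) (simp_all only: alternating_binomial_indicator[OF le assms])
  also have "\<dots> = (\<Sum>j\<le>N - p. (-1) ^ j * real (p + j choose p) * real (\<Sum>c\<in>?C. num_containing c choose (p + j)))"
    by (subst sum.swap) (simp add: sum_distrib_left)
  also have "\<dots> = (\<Sum>j\<le>N - p. T * (real (N choose p) * ((-1) ^ j * real (N - p choose j) * pair_moment (p + j))))"
  proof (rule sum.cong, goal_cases)
    case (2 j)
    then have j: "p + j \<le> N" using assms by auto
    have "(\<Sum>c\<in>?C. num_containing c choose (p + j)) =
       (2 * Suc N choose (2 * (p + j) + 2)) * fact (p + j) * matching_count (N - (p + j))"
      using sum_configurations_choose[of "p + j" "Suc N"] j by simp
    then have "real (\<Sum>c\<in>?C. num_containing c choose (p + j)) =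
       T * (real (N choose (p + j)) * pair_moment (p + j))"
      unfolding T_def by (simp only: matching_count_ratio[OF j])
    \<comment> \<open>This rearrangement isolates \<open>N choose p\<close>, which does not depend
      on \<open>j\<close>.\<close>
    moreover have "real (N choose (p + j)) * real (p + j choose p) = real (N choose p) * real (N - p choose j)"
      using choose_mult[of p "p + j" N] j by (simp flip: of_nat_mult)
    ultimately show ?case by (simp add: algebra_simps)
  qed simp
  finally have "real (G_count (Suc N) p) =
    T * (real (N choose p) * (\<Sum>j\<le>N - p. (-1) ^ j * real (N - p choose j) * pair_moment (p + j)))"
    by (simp add: sum_distrib_left)
  then show ?thesis using T by (simp add: G_dist_def T_def matching_count_def)
qed

section \<open>Moments of the limit density\<close>

definition pair_density :: "real \<Rightarrow> real" where
  "pair_density t = (if t < 1 / 2 then 2 * artanh (sqrt (1 - 2 * t)) else 0)"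

text \<open>With \<open>s = sqrt (1 - 2 * t)\<close> one has
  \<open>(1 + s) / (1 - s) = (1 + s)\<^sup>2 / (2 * t)\<close>, which confines the singularity of
  the density at 0 to \<open>ln (2 * t)\<close>.\<close>

lemma times_pair_density_eq:
  assumes "0 \<le> t" "t \<le> 1 / 2"
  shows "t * pair_density t = 2 * t * ln (1 + sqrt (1 - 2 * t)) - t * ln (2 * t)"
proof -
  consider "t = 0" | "t = 1 / 2" | "0 < t" "t < 1 / 2" using assms by fastforce
  then show ?thesis
  proof cases
    case 3
    define s where "s = sqrt (1 - 2 * t)"
    have s: "0 < s" "s < 1" "s\<^sup>2 = 1 - 2 * t" using 3 by (auto simp: s_def)
    have "2 * t = (1 + s) * (1 - s)" using s(3) by (simp add: algebra_simps power2_eq_square)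
    then have "(1 + s) / (1 - s) = (1 + s)\<^sup>2 / (2 * t)"
      using s by (simp add: power2_eq_square)
    then have "2 * artanh s = ln ((1 + s)\<^sup>2 / (2 * t))"
      by (simp add: artanh_def)
    also have "\<dots> = 2 * ln (1 + s) - ln (2 * t)"
      using s 3 by (simp add: ln_div ln_realpow)
    finally have "pair_density t = 2 * ln (1 + s) - ln (2 * t)" using 3 by (simp add: pair_density_def s_def)
    then show ?thesis by (simp add: s_def right_diff_distrib)
  next
    case 2
    then show ?thesis unfolding 2 by (simp add: pair_density_def)
  qed simp
qed

lemma continuous_on_times_ln: "continuous_on {0..} (\<lambda>t::real. t * ln (2 * t))"
proof (rule continuous_on_eq_continuous_within[THEN iffD2], rule ballI)
  fix t :: real assume "t \<in> {0..}"
  show "continuous (at t within {0..}) (\<lambda>t. t * ln (2 * t))"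
  proof (cases "t = 0")
    case True
    have "((\<lambda>t::real. t * ln (2 * t)) \<longlongrightarrow> 0) (at_right 0)" by real_asymp
    then show ?thesis unfolding True continuous_within
      by (simp add: at_within_Ici_at_right)
  next
    case False
    then show ?thesis using \<open>t \<in> {0..}\<close> by (auto intro!: continuous_intros)
  qed
qed

text \<open>The logarithmic formula on \<open>{0..1/2}\<close> and the zero function on
  \<open>{1/2..1}\<close> agree at \<open>1/2\<close>.\<close>

lemma continuous_on_times_pair_density: "continuous_on {0..1} (\<lambda>t. t * pair_density t)"
proof -
  have *: "continuous_on {0..1/2} (\<lambda>t::real. 2 * t * ln (1 + sqrt (1 - 2 * t)) - t * ln (2 * t))"
  proof (rule continuous_on_diff)
    have "1 + sqrt (1 - 2 * x) \<noteq> 0" if "x \<in> {0..1/2}" for x :: real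
    proof -
      have "sqrt (1 - 2 * x) \<ge> 0" using that by simp
      then show ?thesis by linarith
    qed
    then show "continuous_on {0..1/2} (\<lambda>t::real. 2 * t * ln (1 + sqrt (1 - 2 * t)))"
      by (intro continuous_on_mult continuous_on_ln continuous_on_add continuous_on_real_sqrt
          continuous_on_diff continuous_on_const continuous_on_id) auto
    show "continuous_on {0..1/2} (\<lambda>t::real. t * ln (2 * t))"
      by (rule continuous_on_subset[OF continuous_on_times_ln]) auto
  qed
  have "continuous_on {0..1/2} (\<lambda>t. t * pair_density t)"
    by (rule continuous_on_eq[OF *]) (simp add: times_pair_density_eq)
  moreover have "continuous_on {1/2..1} (\<lambda>t. t * pair_density t)"
    by (rule continuous_on_eq[of _ "\<lambda>_. 0"]) (auto simp: pair_density_def)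
  ultimately have "continuous_on ({0..1/2} \<union> {1/2..1}) (\<lambda>t. t * pair_density t)"
    by (intro continuous_on_closed_Un) auto
  then show ?thesis by (simp add: ivl_disj_un)
qed

section \<open>Antiderivatives and the recursion of the moments\<close>

lemma has_derivative_sqrt_linear:
  assumes "t < 1 / 2"
  shows "((\<lambda>t. sqrt (1 - 2 * t)) has_real_derivative - 1 / sqrt (1 - 2 * t)) (at t)"
  using assms by (auto intro!: derivative_eq_intros simp: field_simps)

text \<open>For \<open>s = sqrt (1 - 2 * t)\<close> the derivative of \<open>artanh\<close> at
  \<open>s\<close> is \<open>1 / (1 - s\<^sup>2) = 1 / (2 * t)\<close>, and \<open>s\<close> itself
  has derivative \<open>- 1 / s\<close>.\<close>

lemma has_derivative_pair_density:
  assumes "0 < t" "t < 1 / 2"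
  shows "(pair_density has_real_derivative - 1 / (t * sqrt (1 - 2 * t))) (at t)"
proof -
  have "((\<lambda>t. 2 * artanh (sqrt (1 - 2 * t))) has_real_derivative - 1 / (t * sqrt (1 - 2 * t))) (at t)"
  proof -
    have "((\<lambda>t. artanh (sqrt (1 - 2 * t))) has_real_derivative
        1 / (1 - (sqrt (1 - 2 * t))\<^sup>2) * (- 1 / sqrt (1 - 2 * t))) (at t)"
      using assms by (intro DERIV_chain2[OF artanh_real_has_field_derivative has_derivative_sqrt_linear]) auto
    from DERIV_cmult[OF this, of 2] show ?thesis using assms by simp
  qed
  then show ?thesis
    by (rule has_field_derivative_transform_within_open[of _ _ _ "{..<1/2}"])
      (use assms in \<open>auto simp: pair_density_def\<close>)
qed

lemma has_integral_extend_by_zero: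
  assumes "(f has_integral I) {0..1/2}" "\<And>t. t \<in> {1/2..1} \<Longrightarrow> f t = 0"
  shows "((f :: real \<Rightarrow> real) has_integral I) {0..1}"
  using has_integral_combine[of 0 "1/2" 1 f I 0] assms has_integral_is_0[of "{1/2..1}" f] by auto

text \<open>The integrals of the density against powers satisfy the same recursion.\<close>

lemma pair_moment_rec:
  assumes "k \<ge> 1"
  shows "(2 * real k + 1) * (real k + 1) * pair_moment k = (real k)\<^sup>2 * pair_moment (k - 1)"
proof -
  obtain j where "k = Suc j" using assms by (cases k) auto
  then show ?thesis
    by (simp add: pair_moment_def divide_simps power2_eq_square)
qed

text \<open>Keeping one factor \<open>t\<close> with the density makes the integrand continuous at
  0, whence the index \<open>Suc k\<close>.\<close>

lemma has_integral_power_pair_density: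
  "((\<lambda>t. t ^ k * (t * pair_density t)) has_integral pair_moment (Suc k)) {0..1}"
proof (induction k)
  case 0
  \<comment> \<open>The antiderivatives use \<open>f' = - 1 / (t * s)\<close> and \<open>s' = - 1 / s\<close> for \<open>s = sqrt (1 - 2 * t)\<close>. The
    induction step uses the derivative \<open>(2 * K + 1) * (K + 1) * t ^ K * f - K\<^sup>2 * t ^ (K - 1) * f\<close> of
    \<open>(2 * K + 1) * t ^ (K + 1) * f - K * t ^ K * f - t ^ K * s\<close>, a function that vanishes at both ends.\<close>
  let ?F = "\<lambda>t. (3 * t * (t * pair_density t) - (t + 1) * sqrt (1 - 2 * t)) / 6"
  have cont: "continuous_on {0..1/2} (\<lambda>t. t * pair_density t)"
    by (rule continuous_on_subset[OF continuous_on_times_pair_density]) auto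
  have "((\<lambda>t. t * pair_density t) has_integral (?F (1/2) - ?F 0)) {0..1/2}"
  proof (rule fundamental_theorem_of_calculus_interior)
    show "continuous_on {0..1/2} ?F" by ((rule cont continuous_intros)+, simp_all)
  next
    fix t :: real assume "t \<in> {0<..<1/2}"
    then have t: "0 < t" "t < 1 / 2" by auto
    define s where "s = sqrt (1 - 2 * t)"
    have s: "s > 0" "s * s = 1 - 2 * t" using t by (auto simp: s_def)
    have "(?F has_real_derivative
       ((3 * 1) * (t * pair_density t) + (1 * pair_density t + (- 1 / (t * s)) * t) * (3 * t)
        - (1 * s + (- 1 / s) * (t + 1))) / 6) (at t)"
      unfolding s_def using t
      by (intro DERIV_cdivide DERIV_diff DERIV_mult DERIV_cmult DERIV_ident has_derivative_pair_density has_derivative_sqrt_linear)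
        (auto intro!: derivative_eq_intros)
    moreover have "((3 * 1) * (t * pair_density t) + (1 * pair_density t + (- 1 / (t * s)) * t) * (3 * t)
        - (1 * s + (- 1 / s) * (t + 1))) / 6 = t * pair_density t"
    proof -
      have "s * (s * s) + s * (t * 2) = s" using s(2) by algebra
      then show ?thesis using t s(1) by (simp add: field_simps)
    qed
    ultimately show "(?F has_vector_derivative t * pair_density t) (at t)"
      unfolding has_real_derivative_iff_has_vector_derivative[symmetric] by (simp only:)
  qed simp
  \<comment> \<open>\<open>?F\<close> is 0 at \<open>1/2\<close> and \<open>- 1/6\<close> at 0, and
    \<open>pair_moment 1 = 1/6\<close>.\<close>
  then show ?case
    by (intro has_integral_extend_by_zero) (auto simp: pair_density_def pair_moment_def fact_numeral)
next
  case (Suc k)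
  let ?K = "real (Suc (Suc k))"
  let ?h = "\<lambda>t. t * pair_density t"
  let ?F = "\<lambda>t. (2 * ?K + 1) * (t ^ Suc (Suc k) * ?h t) - ?K * (t ^ Suc k * ?h t) - t ^ Suc (Suc k) * sqrt (1 - 2 * t)"
  have h: "continuous_on {0..1/2} ?h"
    by (rule continuous_on_subset[OF continuous_on_times_pair_density]) auto
  have cont: "continuous_on {0..1/2} (\<lambda>t. t ^ m * ?h t)" for m
    by (rule continuous_on_mult[OF _ h]) (intro continuous_intros)
  have conts: "continuous_on {0..1/2} (\<lambda>t::real. t ^ m * sqrt (1 - 2 * t))" for m
    by (intro continuous_intros)
  have "((\<lambda>t. (2 * ?K + 1) * (?K + 1) * (t ^ Suc k * ?h t) - ?K\<^sup>2 * (t ^ k * ?h t))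
          has_integral (?F (1/2) - ?F 0)) {0..1/2}"
  proof (rule fundamental_theorem_of_calculus_interior)
    show "continuous_on {0..1/2} ?F" by (intro continuous_on_diff continuous_on_mult_left cont conts)
  next
    fix t :: real assume "t \<in> {0<..<1/2}"
    then have t: "0 < t" "t < 1 / 2" by auto
    define s where "s = sqrt (1 - 2 * t)"
    define f where "f = pair_density t"
    have s: "s > 0" "s * s = 1 - 2 * t" using t by (auto simp: s_def)
    have hd: "(?h has_real_derivative 1 * f + (- 1 / (t * s)) * t) (at t)"
      unfolding s_def f_def using t by (intro DERIV_mult DERIV_ident has_derivative_pair_density)
    have pw: "((\<lambda>t. t ^ Suc n) has_real_derivative (1 + real n) * t ^ n) (at t)" for n
      using DERIV_pow[of "Suc n" t] by simp
    have "(?F has_real_derivative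
       ((2 * ?K + 1) * (((1 + real (Suc k)) * t ^ Suc k) * (t * f) + (1 * f + (- 1 / (t * s)) * t) * t ^ Suc (Suc k))
        - ?K * (((1 + real k) * t ^ k) * (t * f) + (1 * f + (- 1 / (t * s)) * t) * t ^ Suc k)
        - (((1 + real (Suc k)) * t ^ Suc k) * s + (- 1 / s) * t ^ Suc (Suc k)))) (at t)"
      unfolding s_def f_def using t
      by (intro DERIV_diff DERIV_cmult DERIV_mult[OF pw] hd[unfolded s_def f_def] has_derivative_sqrt_linear) auto
    moreover have "((2 * ?K + 1) * (((1 + real (Suc k)) * t ^ Suc k) * (t * f) + (1 * f + (- 1 / (t * s)) * t) * t ^ Suc (Suc k))
        - ?K * (((1 + real k) * t ^ k) * (t * f) + (1 * f + (- 1 / (t * s)) * t) * t ^ Suc k)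
        - (((1 + real (Suc k)) * t ^ Suc k) * s + (- 1 / s) * t ^ Suc (Suc k)))
       = (2 * ?K + 1) * (?K + 1) * (t ^ Suc k * (t * f)) - ?K\<^sup>2 * (t ^ k * (t * f))"
    proof -
      \<comment> \<open>Writing \<open>1 / s\<close> as \<open>s / (1 - 2 * t)\<close> makes the
        identity linear in \<open>s\<close>, so no relation for \<open>s * s\<close> is needed
        afterwards.\<close>
      have *: "(- 1 / (t * s)) * t = - s / (1 - 2 * t)" "- 1 / s = - s / (1 - 2 * t)"
        using t s by (simp_all add: field_simps)
      then show ?thesis unfolding * using t
        by (simp add: divide_simps) (simp add: algebra_simps power2_eq_square)
    qed
    ultimately show "(?F has_vector_derivative (2 * ?K + 1) * (?K + 1) * (t ^ Suc k * ?h t) - ?K\<^sup>2 * (t ^ k * ?h t)) (at t)"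
      unfolding has_real_derivative_iff_has_vector_derivative[symmetric] f_def by (simp only:)
  qed simp
  then have "((\<lambda>t. (2 * ?K + 1) * (?K + 1) * (t ^ Suc k * ?h t) - ?K\<^sup>2 * (t ^ k * ?h t)) has_integral 0) {0..1}"
    by (intro has_integral_extend_by_zero) (auto simp: pair_density_def)
  \<comment> \<open>Adding the induction hypothesis times \<open>?K\<^sup>2\<close> isolates the
    next moment.\<close>
  then have "((\<lambda>t. ((2 * ?K + 1) * (?K + 1) * (t ^ Suc k * ?h t) - ?K\<^sup>2 * (t ^ k * ?h t)) + ?K\<^sup>2 * (t ^ k * ?h t))
      has_integral 0 + ?K\<^sup>2 * pair_moment (Suc k)) {0..1}"
    by (intro has_integral_add has_integral_mult_right Suc.IH)
  then have "((\<lambda>t. ((2 * ?K + 1) * (?K + 1)) * (t ^ Suc k * ?h t)) has_integral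
      ((2 * ?K + 1) * (?K + 1)) * pair_moment (Suc (Suc k))) {0..1}"
    using pair_moment_rec[of "Suc (Suc k)"] by (simp only: diff_add_cancel add_0 diff_Suc_1)
  moreover have "(2 * ?K + 1) * (?K + 1) \<noteq> 0" by (simp add: add_nonneg_eq_0_iff)
  ultimately show ?case by (subst (asm) has_integral_mult_right_iff) simp_all
qed

section \<open>Concentration of the beta kernel\<close>

text \<open>Integration by parts trades a power of \<open>1 - t\<close> for a power of
  \<open>t\<close>; the boundary terms vanish.\<close>

lemma has_integral_beta_nat:
  "((\<lambda>t::real. t ^ a * (1 - t) ^ b) has_integral fact a * fact b / fact (a + b + 1)) {0..1}"
proof (induction b arbitrary: a)
  case 0
  have "((\<lambda>t::real. t ^ a) has_integral 1 ^ Suc a / Suc a - 0 ^ Suc a / Suc a) {0..1}"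
  proof (rule fundamental_theorem_of_calculus)
    fix t :: real
    show "((\<lambda>t. t ^ Suc a / Suc a) has_vector_derivative t ^ a) (at t within {0..1})"
      unfolding has_real_derivative_iff_has_vector_derivative[symmetric]
      using DERIV_cdivide[OF DERIV_pow[of "Suc a" t], of "real (Suc a)"] by simp
  qed simp
  then show ?case by (simp add: divide_simps)
next
  case (Suc b)
  let ?F = "\<lambda>t::real. t ^ Suc a * (1 - t) ^ Suc b / Suc a"
  have "((\<lambda>t::real. t ^ a * (1 - t) ^ Suc b - (Suc b / Suc a) * (t ^ Suc a * (1 - t) ^ b))
      has_integral ?F 1 - ?F 0) {0..1}"
  proof (rule fundamental_theorem_of_calculus)
    fix t :: real
    have "((\<lambda>t. t ^ Suc a) has_real_derivative (1 + real a) * t ^ a) (at t within {0..1})"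
      using DERIV_pow[of "Suc a" t] by simp
    moreover have "((\<lambda>t. 1 - t) has_real_derivative - 1) (at t within {0..1})"
      by (auto intro!: derivative_eq_intros)
    then have "((\<lambda>t. (1 - t) ^ Suc b) has_real_derivative - ((1 + real b) * (1 - t) ^ b)) (at t within {0..1})"
      using DERIV_power_Suc[of "\<lambda>t. 1 - t" "- 1" t "{0..1}" b] by simp
    ultimately have "(?F has_real_derivative
       ((1 + real a) * t ^ a * (1 - t) ^ Suc b + - ((1 + real b) * (1 - t) ^ b) * t ^ Suc a) / Suc a) (at t within {0..1})"
      by (intro DERIV_cdivide DERIV_mult)
    moreover have "((1 + real a) * u * v + - ((1 + real b) * y) * z) / Suc a = u * v - (Suc b / Suc a) * (z * y)"
      for u v y z :: real by (simp add: field_simps)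
    ultimately show "(?F has_vector_derivative
        t ^ a * (1 - t) ^ Suc b - (Suc b / Suc a) * (t ^ Suc a * (1 - t) ^ b)) (at t within {0..1})"
      unfolding has_real_derivative_iff_has_vector_derivative[symmetric] by (simp only:)
  qed simp
  then have "((\<lambda>t::real. (t ^ a * (1 - t) ^ Suc b - (Suc b / Suc a) * (t ^ Suc a * (1 - t) ^ b))
      + (Suc b / Suc a) * (t ^ Suc a * (1 - t) ^ b)) has_integral
      (?F 1 - ?F 0) + (Suc b / Suc a) * (fact (Suc a) * fact b / fact (Suc a + b + 1))) {0..1}"
    by (intro has_integral_add has_integral_mult_right Suc.IH)
  moreover have "(?F 1 - ?F 0) + (Suc b / Suc a) * (fact (Suc a) * fact b / fact (Suc a + b + 1)) =
      (fact a * fact (Suc b) / fact (a + Suc b + 1) :: real)"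
    by (simp add: divide_simps del: of_nat_Suc)
  ultimately show ?case by (simp only: diff_add_cancel)
qed

text \<open>For \<open>1 \<le> p \<le> N\<close> this is the beta density with parameters
  \<open>p\<close> and \<open>N - p + 1\<close>.\<close>

definition beta_kernel :: "nat \<Rightarrow> nat \<Rightarrow> real \<Rightarrow> real" where
  "beta_kernel N p t = real p * real (N choose p) * (t ^ (p - 1) * (1 - t) ^ (N - p))"

lemma integral_beta_kernel:
  assumes "1 \<le> p" "p \<le> N"
  shows "integral {0..1} (beta_kernel N p) = 1"
    and "integral {0..1} (\<lambda>t. t * beta_kernel N p t) = real p / (real N + 1)"
    and "integral {0..1} (\<lambda>t. t\<^sup>2 * beta_kernel N p t) =
      real p / (real N + 1) * ((real p + 1) / (real N + 2))"
proof -
  obtain q where q: "p = Suc q" using assms by (cases p) auto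
  obtain d where d: "N = p + d" using assms le_Suc_ex by blast
  have C: "real (N choose p) = fact N / (fact p * fact d)"
    by (subst binomial_fact) (use assms d in auto)
  \<comment> \<open>A factor \<open>t ^ m\<close> only shifts an exponent, so every moment is again
    a beta integral; \<open>m = 0, 1, 2\<close> give the three claims.\<close>
  have I: "integral {0..1} (\<lambda>t. t ^ m * beta_kernel N p t) = fact N * fact (q + m) / (fact q * fact (N + m))" for m
  proof -
    have "((\<lambda>t. real p * real (N choose p) * (t ^ (q + m) * (1 - t) ^ d)) has_integral
      real p * real (N choose p) * (fact (q + m) * fact d / fact (q + m + d + 1))) {0..1}"
      by (intro has_integral_mult_right has_integral_beta_nat)
    moreover have "(\<lambda>t. real p * real (N choose p) * (t ^ (q + m) * (1 - t) ^ d)) = (\<lambda>t. t ^ m * beta_kernel N p t)"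
      by (auto simp: beta_kernel_def q d power_add)
    moreover have "q + m + d + 1 = N + m" by (simp add: q d)
    moreover have "real p * real (N choose p) * (fact (q + m) * fact d / fact (N + m)) =
       fact N * fact (q + m) / (fact q * fact (N + m))"
      unfolding C by (simp add: q divide_simps del: of_nat_Suc)
    ultimately show ?thesis by (simp only: integral_unique)
  qed
  show "integral {0..1} (beta_kernel N p) = 1" using I[of 0] by simp
  show "integral {0..1} (\<lambda>t. t * beta_kernel N p t) = real p / (real N + 1)"
    using I[of 1] by (simp add: q divide_simps add.commute)
  show "integral {0..1} (\<lambda>t. t\<^sup>2 * beta_kernel N p t) =
      real p / (real N + 1) * ((real p + 1) / (real N + 2))"
    using I[of 2] by (simp add: q divide_simps numeral_2_eq_2) (simp add: algebra_simps)
qed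

text \<open>Expanding \<open>(1 - t) ^ (N - p)\<close> and integrating termwise gives the
  alternating sum of moments. The factor \<open>p\<close> normalizes the kernel, whose exponent is
  \<open>p - 1\<close> because one \<open>t\<close> stays with the density.\<close>

lemma G_dist_eq_integral:
  assumes "1 \<le> p" "p \<le> N"
  shows "real p * G_dist (Suc N) p = integral {0..1} (\<lambda>t. beta_kernel N p t * (t * pair_density t))"
proof -
  let ?S = "\<Sum>j\<le>N - p. (-1) ^ j * real (N - p choose j) * pair_moment (p + j)"
  obtain q where q: "p = Suc q" using assms by (cases p) auto
  have "((\<lambda>t. real p * real (N choose p) * (\<Sum>j\<le>N - p. (-1) ^ j * real (N - p choose j) * (t ^ (q + j) * (t * pair_density t))))
     has_integral real p * real (N choose p) * ?S) {0..1}"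
    unfolding q add_Suc
    by (intro has_integral_mult_right has_integral_sum has_integral_power_pair_density) auto
  moreover have "real p * real (N choose p) * (\<Sum>j\<le>N - p. (-1) ^ j * real (N - p choose j) * (t ^ (q + j) * (t * pair_density t)))
     = beta_kernel N p t * (t * pair_density t)" for t
  proof -
    have "(1 - t) ^ (N - p) = (\<Sum>j\<le>N - p. real (N - p choose j) * (- t) ^ j)"
      using binomial_ring[of "- t" 1 "N - p"] by simp
    also have "\<dots> = (\<Sum>j\<le>N - p. (-1) ^ j * real (N - p choose j) * t ^ j)"
      by (simp add: power_minus[of t] mult_ac)
    finally show ?thesis
      by (simp add: beta_kernel_def q power_add sum_distrib_left sum_distrib_right mult_ac)
  qed
  ultimately show ?thesis using G_dist_alternating[OF assms(2)] by (simp add: integral_unique)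
qed

text \<open>As in Korovkin's theorem, continuity and boundedness give
  \<open>\<bar>h t - h x\<bar> \<le> e / 2 + K * (t - x)\<^sup>2\<close>, so only the first two moments of the kernel matter.\<close>

lemma kernel_concentration:
  fixes w :: "nat \<Rightarrow> real \<Rightarrow> real" and h :: "real \<Rightarrow> real"
  assumes x: "x \<in> {0..1}" and h: "continuous_on {0..1} h"
    and cont: "\<And>n. continuous_on {0..1} (w n)"
    and nonneg: "\<And>n t. t \<in> {0..1} \<Longrightarrow> 0 \<le> w n t"
    and mass: "\<forall>\<^sub>F n in sequentially. integral {0..1} (w n) = 1"
    and m1: "(\<lambda>n. integral {0..1} (\<lambda>t. t * w n t)) \<longlonglongrightarrow> x"
    and m2: "(\<lambda>n. integral {0..1} (\<lambda>t. t\<^sup>2 * w n t)) \<longlonglongrightarrow> x\<^sup>2"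
  shows "(\<lambda>n. integral {0..1} (\<lambda>t. w n t * h t)) \<longlonglongrightarrow> h x"
proof (rule tendstoI)
  fix e :: real assume e: "e > 0"
  have "bounded (h ` {0..1})" using h by (intro compact_imp_bounded compact_continuous_image) auto
  then obtain M where M: "M > 0" "\<And>t. t \<in> {0..1} \<Longrightarrow> \<bar>h t\<bar> \<le> M"
    unfolding bounded_pos by auto
  obtain d where d: "d > 0" "\<And>t. t \<in> {0..1} \<Longrightarrow> \<bar>t - x\<bar> < d \<Longrightarrow> \<bar>h t - h x\<bar> < e / 2"
    using h x e unfolding continuous_on_iff dist_real_def by (metis half_gt_zero)
  \<comment> \<open>Chosen so that \<open>K * (t - x)\<^sup>2\<close> is at least
    \<open>2 * M\<close>, a bound for the variation of \<open>h\<close>, once \<open>t\<close> is at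
    distance \<open>d\<close> or more from \<open>x\<close>.\<close>
  define K where "K = 2 * M / d\<^sup>2"
  have K: "K > 0" using M d by (simp add: K_def)
  have bound: "\<bar>h t - h x\<bar> \<le> e / 2 + K * (t - x)\<^sup>2" if t: "t \<in> {0..1}" for t
  proof (cases "\<bar>t - x\<bar> < d")
    case True
    have "0 \<le> K * (t - x)\<^sup>2" using K by simp
    then show ?thesis using d(2)[OF t True] by linarith
  next
    case False
    then have "d\<^sup>2 \<le> (t - x)\<^sup>2" using d(1) by (simp add: abs_le_square_iff[symmetric])
    then have "K * d\<^sup>2 \<le> K * (t - x)\<^sup>2" using K by simp
    moreover have "K * d\<^sup>2 = 2 * M" using d by (simp add: K_def)
    ultimately show ?thesis using M(2)[OF t] M(2)[OF x] e by linarith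
  qed
  \<comment> \<open>For total mass 1 this is the second moment of the kernel about \<open>x\<close>,
    which tends to 0.\<close>
  let ?V = "\<lambda>n. integral {0..1} (\<lambda>t. t\<^sup>2 * w n t) - 2 * x * integral {0..1} (\<lambda>t. t * w n t) + x\<^sup>2"
  have "(\<lambda>n. K * ?V n) \<longlonglongrightarrow> K * (x\<^sup>2 - 2 * x * x + x\<^sup>2)"
    by (intro tendsto_intros m1 m2)
  then have "(\<lambda>n. K * ?V n) \<longlonglongrightarrow> 0" by (simp add: power2_eq_square)
  then have "\<forall>\<^sub>F n in sequentially. K * ?V n < e / 2" using e by (intro order_tendstoD(2)[of _ 0]) auto
  with mass show "\<forall>\<^sub>F n in sequentially. dist (integral {0..1} (\<lambda>t. w n t * h t)) (h x) < e"
  proof eventually_elim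
    case (elim n)
    have iw: "(w n has_integral 1) {0..1}"
      using integrable_integral[OF integrable_continuous_interval[OF cont[of n]]] elim(1) by simp
    have i1: "((\<lambda>t. t * w n t) has_integral integral {0..1} (\<lambda>t. t * w n t)) {0..1}"
      by (intro integrable_integral integrable_continuous_interval continuous_intros cont)
    have i2: "((\<lambda>t. t\<^sup>2 * w n t) has_integral integral {0..1} (\<lambda>t. t\<^sup>2 * w n t)) {0..1}"
      by (intro integrable_integral integrable_continuous_interval continuous_intros cont)
    have ih: "((\<lambda>t. w n t * h t) has_integral integral {0..1} (\<lambda>t. w n t * h t)) {0..1}"
      by (intro integrable_integral integrable_continuous_interval continuous_intros cont h)
    have "((\<lambda>t. w n t * h t - h x * w n t) has_integral integral {0..1} (\<lambda>t. w n t * h t) - h x * 1) {0..1}"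
      by (intro has_integral_diff has_integral_mult_right ih iw)
    moreover have "((\<lambda>t. e / 2 * w n t + K * (t\<^sup>2 * w n t - 2 * x * (t * w n t) + x\<^sup>2 * w n t)) has_integral
       e / 2 * 1 + K * (integral {0..1} (\<lambda>t. t\<^sup>2 * w n t) - 2 * x * integral {0..1} (\<lambda>t. t * w n t) + x\<^sup>2 * 1)) {0..1}"
      by (intro has_integral_add has_integral_diff has_integral_mult_right iw i1 i2)
    moreover have "norm (w n t * h t - h x * w n t) \<le>
        e / 2 * w n t + K * (t\<^sup>2 * w n t - 2 * x * (t * w n t) + x\<^sup>2 * w n t)" if t: "t \<in> {0..1}" for t
    proof -
      have "w n t * h t - h x * w n t = w n t * (h t - h x)" by (simp add: algebra_simps)
      then have "norm (w n t * h t - h x * w n t) = w n t * \<bar>h t - h x\<bar>"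
        using nonneg[OF t, of n] by (simp add: abs_mult)
      also have "\<dots> \<le> w n t * (e / 2 + K * (t - x)\<^sup>2)"
        using bound[OF t] nonneg[OF t] by (rule mult_left_mono)
      also have "\<dots> = e / 2 * w n t + K * (t\<^sup>2 * w n t - 2 * x * (t * w n t) + x\<^sup>2 * w n t)"
        by (simp add: power2_eq_square algebra_simps)
      finally show ?thesis .
    qed
    ultimately have "norm (integral {0..1} (\<lambda>t. w n t * h t) - h x * 1) \<le> e / 2 * 1 + K * (?V n - x\<^sup>2 + x\<^sup>2 * 1)"
      using integral_norm_bound_integral[of "\<lambda>t. w n t * h t - h x * w n t" "{0..1}"
          "\<lambda>t. e / 2 * w n t + K * (t\<^sup>2 * w n t - 2 * x * (t * w n t) + x\<^sup>2 * w n t)"]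
      by (simp add: has_integral_iff)
    then show ?case using elim(2) by (simp add: dist_real_def)
  qed
qed

section \<open>Passage to the limit\<close>

theorem theorem21:
  fixes x :: real
  assumes "0 < x" and "x \<le> 1"
  shows "has_asymptotic_value x (if x < 1 / 2 then 2 * artanh (sqrt (1 - 2 * x)) else 0)"
  unfolding has_asymptotic_value_def pair_density_def[symmetric]
proof (intro allI impI, elim conjE)
  fix p :: "nat \<Rightarrow> nat"
  assume le: "\<forall>n\<ge>1. p n \<le> n - 1" and lim: "(\<lambda>n. real (p n) / real (n - 1)) \<longlonglongrightarrow> x"
  let ?I = "\<lambda>n. integral {0..1} (\<lambda>t. beta_kernel (n - 1) (p n) t * (t * pair_density t))"
  \<comment> \<open>As \<open>x > 0\<close>, the ratio is eventually positive, which excludes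
    \<open>p n = 0\<close>; the kernel is then a probability density.\<close>
  have ev: "\<forall>\<^sub>F n in sequentially. 2 \<le> n \<and> 1 \<le> p n \<and> p n \<le> n - 1"
    using order_tendstoD(1)[OF lim \<open>0 < x\<close>] eventually_ge_at_top[of 2]
  proof eventually_elim
    case (elim n)
    then show ?case using le by (cases "p n = 0") auto
  qed
  have l1: "(\<lambda>n. real (n - 1) / (real (n - 1) + 1)) \<longlonglongrightarrow> 1"
    and l2: "(\<lambda>n. real (n - 1) / (real (n - 1) + 2)) \<longlonglongrightarrow> 1"
    and l3: "(\<lambda>n. 1 / (real (n - 1) + 2)) \<longlonglongrightarrow> 0"
    by real_asymp+
  \<comment> \<open>This is the mean of the kernel; the second moment is its product with the
    sequence in \<open>m2\<close>, hence tends to \<open>x * x\<close>.\<close>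
  have m1: "(\<lambda>n. real (p n) / (real (n - 1) + 1)) \<longlonglongrightarrow> x"
  proof (rule Lim_transform_eventually)
    show "(\<lambda>n. real (p n) / real (n - 1) * (real (n - 1) / (real (n - 1) + 1))) \<longlonglongrightarrow> x"
      using tendsto_mult[OF lim l1] by simp
    show "\<forall>\<^sub>F n in sequentially. real (p n) / real (n - 1) * (real (n - 1) / (real (n - 1) + 1)) = real (p n) / (real (n - 1) + 1)"
      using ev by eventually_elim simp
  qed
  have m2: "(\<lambda>n. (real (p n) + 1) / (real (n - 1) + 2)) \<longlonglongrightarrow> x"
  proof (rule Lim_transform_eventually)
    show "(\<lambda>n. real (p n) / real (n - 1) * (real (n - 1) / (real (n - 1) + 2)) + 1 / (real (n - 1) + 2)) \<longlonglongrightarrow> x"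
      using tendsto_add[OF tendsto_mult[OF lim l2] l3] by simp
    show "\<forall>\<^sub>F n in sequentially. real (p n) / real (n - 1) * (real (n - 1) / (real (n - 1) + 2)) + 1 / (real (n - 1) + 2)
       = (real (p n) + 1) / (real (n - 1) + 2)"
      using ev by eventually_elim (simp add: add_divide_distrib)
  qed
  have "?I \<longlonglongrightarrow> x * pair_density x"
  proof (rule kernel_concentration)
    show "x \<in> {0..1}" using assms by simp
    show "continuous_on {0..1} (\<lambda>t. t * pair_density t)" by (rule continuous_on_times_pair_density)
    show "continuous_on {0..1} (beta_kernel (n - 1) (p n))" for n
      unfolding beta_kernel_def[abs_def] by (intro continuous_intros)
    show "0 \<le> beta_kernel (n - 1) (p n) t" if "t \<in> {0..1}" for n t
      using that by (simp add: beta_kernel_def)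
    show "\<forall>\<^sub>F n in sequentially. integral {0..1} (beta_kernel (n - 1) (p n)) = 1"
      using ev by eventually_elim (simp add: integral_beta_kernel)
    show "(\<lambda>n. integral {0..1} (\<lambda>t. t * beta_kernel (n - 1) (p n) t)) \<longlonglongrightarrow> x"
      by (rule Lim_transform_eventually[OF m1])
        (use ev in eventually_elim, simp only: integral_beta_kernel)
    show "(\<lambda>n. integral {0..1} (\<lambda>t. t\<^sup>2 * beta_kernel (n - 1) (p n) t)) \<longlonglongrightarrow> x\<^sup>2"
      unfolding power2_eq_square[of x]
      by (rule Lim_transform_eventually[OF tendsto_mult[OF m1 m2]])
        (use ev in eventually_elim, simp only: integral_beta_kernel)
  qed
  \<comment> \<open>The integral is \<open>p n\<close> times the probability, so dividing by
    \<open>p n / (n - 1)\<close> gives the rescaled probability; the limit of the divisor is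
    \<open>x\<close>, which is not 0.\<close>
  then have "(\<lambda>n. ?I n / (real (p n) / real (n - 1))) \<longlonglongrightarrow> x * pair_density x / x"
    using assms by (intro tendsto_divide lim) auto
  then have "(\<lambda>n. ?I n / (real (p n) / real (n - 1))) \<longlonglongrightarrow> pair_density x"
    using assms by simp
  moreover have "\<forall>\<^sub>F n in sequentially. ?I n / (real (p n) / real (n - 1)) = real (n - 1) * G_dist n (p n)"
    using ev
  proof eventually_elim
    case (elim n)
    then have "real (p n) * G_dist n (p n) = ?I n"
      using G_dist_eq_integral[of "p n" "n - 1"] by simp
    then show ?case using elim by (simp add: field_simps flip: \<open>real (p n) * G_dist n (p n) = ?I n\<close>)
  qed
  ultimately show "(\<lambda>n. real (n - 1) * G_dist n (p n)) \<longlonglongrightarrow> pair_density x"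
    by (rule Lim_transform_eventually)
qed

end
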